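(* Let $n\ge1$, let $\lambda\in R$, and let $(a_{i,j})_{0\le i,j\le n}$ be a doubly indexed family of elements of $R$ with $a_{0,0}=2$. Let $A=(A_{i,j})_{0\le i,j\le n}$ be the $(n+1)\times(n+1)$ matrix with $$A_{i,j}=\begin{cases}\lambda a_{0,j} & \text{if } 0=i\ne j,\\ a_{i,j} & \text{if } j=0,\text{ or if } i\geq 1 \text{ and } i+j \text{ is even},\\ \lambda a_{i,0}a_{0,j}-a_{i,j} & \text{otherwise.}\end{cases}$$ Furthermore, define two $n\times n$ matrices $B=(B_{i,j})_{1\le i,j\le n}$ and $C=(C_{i,j})_{1\le i,j\le n}$ by $$B_{i,j}=\lambda a_{i,0}a_{0,j}-a_{i,j},\qquad C_{i,j}=a_{i,j}.$$ Then $$\det A-(-1)^n\det B-\det C=0.$$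
   Context: $R$ is a commutative ring containing $\mathbb{Q}$; in the paper the $a_{i,j}$ (other than $a_{0,0}=2$) and $\lambda$ are thought of as indeterminates. The first row of $A$ is $(2,\lambda a_{0,1},\lambda a_{0,2},\dots,\lambda a_{0,n})$ and the first column of $A$ is $(2,a_{1,0},a_{2,0},\dots,a_{n,0})^t$. *)

theory Defs
  imports "Jordan_Normal_Form.Determinant"
begin

definition A_mat :: "nat \<Rightarrow> 'a :: comm_ring_1 \<Rightarrow> (nat \<Rightarrow> nat \<Rightarrow> 'a) \<Rightarrow> 'a mat" where
  "A_mat n lam a = mat (n + 1) (n + 1) (\<lambda>(i, j).
     if i = 0 \<and> j \<noteq> 0 then lam * a 0 j
     else if j = 0 \<or> (i \<ge> 1 \<and> even (i + j)) then a i j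
     else lam * a i 0 * a 0 j - a i j)"

(* Matrix positions are 0-based, whereas B and C are indexed by 1, ..., n;
   hence the index shift in the following two definitions. *)

definition B_mat :: "nat \<Rightarrow> 'a :: comm_ring_1 \<Rightarrow> (nat \<Rightarrow> nat \<Rightarrow> 'a) \<Rightarrow> 'a mat" where
  "B_mat n lam a = mat n n (\<lambda>(i, j). lam * a (i + 1) 0 * a 0 (j + 1) - a (i + 1) (j + 1))"

definition C_mat :: "nat \<Rightarrow> (nat \<Rightarrow> nat \<Rightarrow> 'a :: comm_ring_1) \<Rightarrow> 'a mat" where
  "C_mat n a = mat n n (\<lambda>(i, j). a (i + 1) (j + 1))"

end

theory Submission
  imports Defs
begin

text \<open>
  Write \<open>u\<close> for the column \<open>(a i 0)\<close>, \<open>v\<close> for the row \<open>(lam * a 0 j)\<close>, with \<open>1 \<le> i, j \<le> n\<close>,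
  and \<open>M s\<close> for the matrix \<open>C\<close> bordered by corner \<open>s\<close>, first row \<open>v\<close> and first column \<open>u\<close>.
  The identity is a decomposition of \<open>det (M 2)\<close>:

  \<^item> Up to sign changes of rows and columns, \<open>A\<close> arises from \<open>M 2\<close> by subtracting \<open>u i\<close> times
    the first row from row \<open>i\<close> and \<open>v j\<close> times the first column from column \<open>j\<close>, for odd \<open>i\<close>
    and odd \<open>j\<close>. Corner \<open>2\<close> is what makes this work: where both operations act, each
    contributes \<open>- u i * v j\<close> and the corner gives back \<open>2 * u i * v j\<close>, so the entry of \<open>C\<close>
    survives. The sign changes are the same for rows and columns and hence cancel in the
    determinant, so \<open>det A = det (M 2)\<close> (lemma \<open>det_flip_bordered\<close>).
  \<^item> Splitting the first row \<open>(2, v)\<close> as \<open>(1, v) + (1, 0)\<close> gives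
    \<open>det (M 2) = det (C - u * v) + det C\<close>, the first summand being the Schur complement formula
    (lemma \<open>det_bordered_two\<close>).

  Finally \<open>B = u * v - C\<close>, so \<open>det (C - u * v) = (- 1) ^ n * det B\<close>.
\<close>

lemma det_row_add:
  fixes X Y Z :: "'a :: comm_ring_1 mat"
  assumes X: "X \<in> carrier_mat n n" and Y: "Y \<in> carrier_mat n n" and Z: "Z \<in> carrier_mat n n"
    and k: "k < n"
    and row: "\<And>j. j < n \<Longrightarrow> X $$ (k, j) = Y $$ (k, j) + Z $$ (k, j)"
    and off_Y: "\<And>i j. i < n \<Longrightarrow> j < n \<Longrightarrow> i \<noteq> k \<Longrightarrow> Y $$ (i, j) = X $$ (i, j)"
    and off_Z: "\<And>i j. i < n \<Longrightarrow> j < n \<Longrightarrow> i \<noteq> k \<Longrightarrow> Z $$ (i, j) = X $$ (i, j)"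
  shows "det X = det Y + det Z"
proof -
  have "mat_delete Y k j = mat_delete X k j" "mat_delete Z k j = mat_delete X k j" for j
    using X Y Z k by (auto simp: mat_delete_def off_Y off_Z intro!: eq_matI)
  then have "cofactor Y k j = cofactor X k j" "cofactor Z k j = cofactor X k j" for j
    by (simp_all add: cofactor_def)
  then show ?thesis
    using laplace_expansion_row[OF X k] laplace_expansion_row[OF Y k] laplace_expansion_row[OF Z k]
    by (simp add: row distrib_right sum.distrib)
qed

lemma det_four_block_one_zero_row:
  fixes D :: "'a :: comm_ring_1 mat"
  assumes u: "u \<in> carrier_mat n 1" and D: "D \<in> carrier_mat n n"
  shows "det (four_block_mat (1\<^sub>m 1) (0\<^sub>m 1 n) u D) = det D"
proof -
  let ?L = "four_block_mat (1\<^sub>m 1) (0\<^sub>m 1 n) u D"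
  have L: "?L \<in> carrier_mat (1 + n) (1 + n)"
    using D by (intro four_block_carrier_mat) simp_all
  have "transpose_mat ?L
      = four_block_mat (1\<^sub>m 1) (transpose_mat u) (0\<^sub>m n 1) (transpose_mat D)"
    using u D by (intro eq_matI) auto
  then have "det (transpose_mat ?L) = det (transpose_mat D)"
    using u D by (simp add: det_four_block_mat_lower_left_zero_col)
  then show ?thesis
    using det_transpose[OF L] det_transpose[OF D] by simp
qed

text \<open>The Schur complement formula for corner \<open>1\<close>: clearing \<open>u\<close> by means of the first row turns
  \<open>C\<close> into \<open>C - u * v\<close>.\<close>

lemma det_bordered_one:
  fixes C :: "'a :: comm_ring_1 mat"
  assumes v: "v \<in> carrier_mat 1 n" and u: "u \<in> carrier_mat n 1" and C: "C \<in> carrier_mat n n"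
  shows "det (four_block_mat (1\<^sub>m 1) v u C) = det (C - u * v)"
proof -
  let ?L = "four_block_mat (1\<^sub>m 1) (0\<^sub>m 1 n) u (1\<^sub>m n)"
  let ?R = "four_block_mat (1\<^sub>m 1) v (0\<^sub>m n 1) (C - u * v)"
  have S: "C - u * v \<in> carrier_mat n n"
    using u v by (intro minus_carrier_mat mult_carrier_mat)
  have cancel: "u * v + (C - u * v) = C"
    using u v C by (intro eq_matI) auto
  have "?L * ?R = four_block_mat (1\<^sub>m 1) v u C"
    using u v C S cancel by (subst mult_four_block_mat[of _ 1 1 _ n _ n _ _ 1 _ n]) simp_all
  moreover have "det (?L * ?R) = det ?L * det ?R"
    using u v S by (intro det_mult[of _ "1 + n"] four_block_carrier_mat) simp_all
  moreover have "det ?L = 1"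
    using det_four_block_one_zero_row[OF u one_carrier_mat] by simp
  moreover have "det ?R = det (C - u * v)"
    using v S by (simp add: det_four_block_mat_lower_left_zero_col)
  ultimately show ?thesis
    by simp
qed

lemma det_bordered_two:
  fixes C :: "'a :: comm_ring_1 mat"
  assumes v: "v \<in> carrier_mat 1 n" and u: "u \<in> carrier_mat n 1" and C: "C \<in> carrier_mat n n"
  shows "det (four_block_mat (2 \<cdot>\<^sub>m 1\<^sub>m 1) v u C) = det (C - u * v) + det C"
proof -
  have "det (four_block_mat (2 \<cdot>\<^sub>m 1\<^sub>m 1) v u C)
      = det (four_block_mat (1\<^sub>m 1) v u C) + det (four_block_mat (1\<^sub>m 1) (0\<^sub>m 1 n) u C)"
    using u v C by (intro det_row_add[of _ "1 + n" _ _ 0] four_block_carrier_mat) auto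
  then show ?thesis
    using det_bordered_one[OF v u C] det_four_block_one_zero_row[OF u C] by simp
qed

text \<open>Row and column operations that flip an arbitrary set \<open>p\<close> of indices; for \<open>A\<close> these are the
  odd ones. The operations are multiplications by unipotent block factors times the same diagonal
  sign matrix on either side.\<close>

lemma det_flip_bordered:
  fixes C :: "'a :: comm_ring_1 mat" and p :: "nat \<Rightarrow> bool"
  assumes v: "v \<in> carrier_mat 1 n" and u: "u \<in> carrier_mat n 1" and C: "C \<in> carrier_mat n n"
  shows "det (four_block_mat (2 \<cdot>\<^sub>m 1\<^sub>m 1) v u
      (mat n n (\<lambda>(i, j). if p i = p j then C $$ (i, j)
        else u $$ (i, 0) * v $$ (0, j) - C $$ (i, j)))) =
    det (four_block_mat (2 \<cdot>\<^sub>m 1\<^sub>m 1) v u C)" (is "det ?F = det ?M")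
proof -
  define d :: "nat \<Rightarrow> 'a" where "d = (\<lambda>i. if p i then - 1 else 1)"
  define D where "D = mat_diag n d"
  define u' where "u' = mat n 1 (\<lambda>(i, j). if p i then u $$ (i, 0) else 0)"
  define v' where "v' = mat 1 n (\<lambda>(i, j). if p j then v $$ (0, j) else 0)"
  let ?L = "four_block_mat (1\<^sub>m 1) (0\<^sub>m 1 n) u' D"
  let ?R = "four_block_mat (1\<^sub>m 1) v' (0\<^sub>m n 1) D"
  have D: "D \<in> carrier_mat n n" and u': "u' \<in> carrier_mat n 1" and v': "v' \<in> carrier_mat 1 n"
    by (simp_all add: D_def u'_def v'_def)
  have col: "u' * (2 \<cdot>\<^sub>m 1\<^sub>m 1) + D * u = u"
    unfolding D_def mat_diag_mult_left[OF u] using u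
    by (intro eq_matI) (auto simp: u'_def d_def scalar_prod_def)
  have row: "(2 \<cdot>\<^sub>m 1\<^sub>m 1) * v' + v * D = v"
    unfolding D_def mat_diag_mult_right[OF v] using v
    by (intro eq_matI) (auto simp: v'_def d_def scalar_prod_def)
  have DC: "u' * v + D * C \<in> carrier_mat n n"
    using D C by (intro add_carrier_mat mult_carrier_mat)
  have block: "u * v' + (u' * v + D * C) * D = mat n n (\<lambda>(i, j). if p i = p j then C $$ (i, j)
      else u $$ (i, 0) * v $$ (0, j) - C $$ (i, j))"
    unfolding mat_diag_mult_right[OF DC, of d, folded D_def]
    unfolding D_def mat_diag_mult_left[OF C]
    using u v C by (intro eq_matI) (auto simp: u'_def v'_def d_def scalar_prod_def)
  have "?L * ?M = four_block_mat (2 \<cdot>\<^sub>m 1\<^sub>m 1) v u (u' * v + D * C)"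
    using u v C u' D col by (subst mult_four_block_mat[of _ 1 1 _ n _ n _ _ 1 _ n]) simp_all
  moreover have "four_block_mat (2 \<cdot>\<^sub>m 1\<^sub>m 1) v u (u' * v + D * C) * ?R = ?F"
    using u v DC v' D row block right_mult_zero_mat[OF DC, of 1] by (subst mult_four_block_mat[of _ 1 1 _ n _ n _ _ 1 _ n]) simp_all
  ultimately have "?L * ?M * ?R = ?F"
    by simp
  moreover have "det (?L * ?M * ?R) = det ?L * det ?M * det ?R"
  proof -
    have "?L \<in> carrier_mat (1 + n) (1 + n)" "?M \<in> carrier_mat (1 + n) (1 + n)"
      "?R \<in> carrier_mat (1 + n) (1 + n)"
      using D C by (intro four_block_carrier_mat; simp)+
    then show ?thesis
      by (metis det_mult mult_carrier_mat)
  qed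
  moreover have "det ?L = det D"
    using u' D by (rule det_four_block_one_zero_row)
  moreover have "det ?R = det D"
    using v' D by (simp add: det_four_block_mat_lower_left_zero_col)
  moreover have "det D * det D = 1"
  proof -
    have "D * D = 1\<^sub>m n"
      unfolding D_def mat_diag_diag by (auto simp: d_def mat_diag_def intro!: eq_matI)
    then show ?thesis
      using det_mult[OF D D] by simp
  qed
  ultimately show ?thesis
    by (metis mult.assoc mult.commute mult_1)
qed

theorem theorem1:
  fixes \<iota> :: "rat \<Rightarrow> 'a :: comm_ring_1"
    and n :: nat
    and lam :: 'a
    and a :: "nat \<Rightarrow> nat \<Rightarrow> 'a"
  assumes "inj_comm_ring_hom \<iota>"
    and "n \<ge> 1"
    and "a 0 0 = 2"
  shows "det (A_mat n lam a) - (- 1) ^ n * det (B_mat n lam a) - det (C_mat n a) = 0"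
proof -
  define u where "u = mat n 1 (\<lambda>(i, j :: nat). a (i + 1) 0)"
  define v where "v = mat 1 n (\<lambda>(i :: nat, j). lam * a 0 (j + 1))"
  have u: "u \<in> carrier_mat n 1" and v: "v \<in> carrier_mat 1 n"
    and C: "C_mat n a \<in> carrier_mat n n"
    by (simp_all add: u_def v_def C_mat_def)
  \<comment> \<open>Position \<open>i\<close> of the block is row \<open>i + 1\<close> of the bordered matrix; parities of two positions
    agree iff those of the shifted ones do.\<close>
  have A: "A_mat n lam a = four_block_mat (2 \<cdot>\<^sub>m 1\<^sub>m 1) v u
      (mat n n (\<lambda>(i, j). if even i = even j then C_mat n a $$ (i, j)
        else u $$ (i, 0) * v $$ (0, j) - C_mat n a $$ (i, j)))"
    using \<open>a 0 0 = 2\<close>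
    by (intro eq_matI) (auto simp: A_mat_def C_mat_def u_def v_def algebra_simps)
  have "det (A_mat n lam a) = det (C_mat n a - u * v) + det (C_mat n a)"
    unfolding A det_flip_bordered[OF v u C] by (rule det_bordered_two[OF v u C])
  moreover have "C_mat n a - u * v = (- 1) \<cdot>\<^sub>m B_mat n lam a"
    by (intro eq_matI) (auto simp: u_def v_def B_mat_def C_mat_def scalar_prod_def algebra_simps)
  moreover have "dim_col (B_mat n lam a) = n"
    by (simp add: B_mat_def)
  ultimately show ?thesis
    by simp
qed

end
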